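(* Let $a\in\mathbb{C}$, let $h(x)=\frac{x^3}{3}+ax$, let $n\ge 0$ be an integer, and let $p(x)$ be a monic wave polynomial of degree $n$. For $k=0,\dots,n$ put $e_k(x)=x^k/k!$ and write $p(x)=\sum_{s=0}^n p_s e_s(x)$ with $p_s\in\mathbb{C}$. Then for every $k=0,\dots,n$, $$e_k(-x)\,p(-x)\ \sim\ \frac{(-1)^n p_{n-k}}{p^2(x)}.$$
   Context: A wave polynomial of degree $n$ is a nonzero polynomial $p(x)\in\mathbb{C}[x]$ for which there exists $b\in\mathbb{C}$ such that $y=p$ satisfies $y''(x)-h'(x)y'(x)+(nx+b)y(x)=0$; such a polynomial has degree exactly $n$ and only simple roots. Define the linear map $D:\mathbb{C}(x)\to\mathbb{C}(x)$ by $D(q)=q'+h'q$, and let $C=D(\mathbb{C}(x))$ be its image. For $q_1,q_2\in\mathbb{C}(x)$, write $q_1\sim q_2$ if and only if $q_1-q_2\in C$. Here $p^2(x)=(p(x))^2$. *)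

theory Defs
  imports Complex_Main "HOL-Computational_Algebra.Computational_Algebra"
begin

text \<open>
  The field of rational functions is the type \<open>complex poly fract\<close>. Its derivation is given by
  the quotient rule on a chosen representative \<open>(u, v)\<close> of \<open>u / v\<close>; by
  \<open>fract_deriv_Fract\<close> the choice does not matter.
\<close>

definition fract_deriv :: "complex poly fract \<Rightarrow> complex poly fract"
  where "fract_deriv q =
    (let (u, v) = rep_fract q in Fract (pderiv u * v - u * pderiv v) (v^2))"

lemma fract_deriv_Fract:
  assumes "v \<noteq> 0"
  shows "fract_deriv (Fract u v) = Fract (pderiv u * v - u * pderiv v) (v^2)"
proof -
  obtain w z where wz: "rep_fract (Fract u v) = (w, z)"
    by fastforce
  have "fractrel (rep_fract (Fract u v)) (rep_fract (Fract u v))"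
    using Quotient_rep_reflp[OF Quotient_fract] .
  then have z: "z \<noteq> 0"
    using wz by simp
  have "Fract w z = abs_fract (w, z)"
    using z by (simp add: Fract.abs_eq)
  also have "\<dots> = Fract u v"
    using Quotient_abs_rep[OF Quotient_fract, of "Fract u v"] wz by simp
  finally have "Fract w z = Fract u v" .
  then have eq: "w * v = u * z"
    using assms z by (simp add: eq_fract)
  have "pderiv (w * v) = pderiv (u * z)"
    by (simp only: eq)
  then have "pderiv w * v + w * pderiv v = pderiv u * z + u * pderiv z"
    by (simp add: pderiv_mult algebra_simps)
  with eq have "(pderiv w * z - w * pderiv z) * v^2 = (pderiv u * v - u * pderiv v) * z^2"
    by algebra
  then show ?thesis
    using assms z wz by (simp add: fract_deriv_def eq_fract)
qed

lemma fract_deriv_to_fract: "fract_deriv (to_fract p) = to_fract (pderiv p)"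
  by (simp add: to_fract_def fract_deriv_Fract pderiv_1)

lemma fract_deriv_add: "fract_deriv (q + r) = fract_deriv q + fract_deriv r"
  by (cases q; cases r)
    (simp add: fract_deriv_Fract eq_fract pderiv_mult pderiv_add algebra_simps power2_eq_square)

lemma fract_deriv_mult: "fract_deriv (q * r) = fract_deriv q * r + q * fract_deriv r"
  by (cases q; cases r)
    (simp add: fract_deriv_Fract eq_fract pderiv_mult algebra_simps power2_eq_square)

definition D_map :: "complex poly \<Rightarrow> complex poly fract \<Rightarrow> complex poly fract"
  where "D_map h q = fract_deriv q + to_fract (pderiv h) * q"

definition D_equiv :: "complex poly \<Rightarrow> complex poly fract \<Rightarrow> complex poly fract \<Rightarrow> bool"
  where "D_equiv h q r \<longleftrightarrow> q - r \<in> range (D_map h)"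

text \<open>
  The parameter \<open>n\<close> is the coefficient of \<open>x\<close> in the differential equation. For
  \<open>h = x^3/3 + a x\<close> a comparison of leading coefficients forces \<open>degree p = n\<close>, so the degree is
  not part of the definition.
\<close>

definition wave_poly :: "complex poly \<Rightarrow> nat \<Rightarrow> complex poly \<Rightarrow> bool"
  where "wave_poly h n p \<longleftrightarrow> p \<noteq> 0 \<and>
    (\<exists>b. pderiv (pderiv p) - pderiv h * pderiv p + [:b, of_nat n:] * p = 0)"

definition exp_monom :: "nat \<Rightarrow> complex poly"
  where "exp_monom k = monom (1 / fact k) k"

text \<open>The polynomial \<open>p(-x)\<close>.\<close>

definition reflect_arg :: "complex poly \<Rightarrow> complex poly"
  where "reflect_arg p = pcompose p [:0, -1:]"

end

theory Submission
  imports Defs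
begin

text \<open>
  Write \<open>h' = x^2 + a\<close> and \<open>D\<^sup>- f = f' - h' f\<close>. The space \<open>\<complex>[x] / D\<^sup>-(\<complex>[x])\<close> has basis \<open>1, x\<close>
  (its dual consists of the functionals \<open>f \<mapsto> \<integral> f exp(-h)\<close>), and it carries the alternating form
  \<open>\<Omega>\<close> with \<open>\<Omega>(1, x) = 1\<close>. The functional \<open>\<nu> = \<Omega>(p, \<cdot>)\<close> kills \<open>p\<close>, and since the classes of \<open>x^k p\<close>
  satisfy the same three-term recurrence as the coefficients \<open>p\<^bsub>n-k\<^esub>\<close>, the class of \<open>e\<^sub>k p\<close> is
  \<open>p\<^bsub>n-k\<^esub> / n!\<close> times that of \<open>p\<close>. Hence \<open>\<nu>\<close> kills \<open>p, x p, \<dots>, x^n p\<close>: \<open>p\<close> is a degenerate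
  orthogonal polynomial. Its associated polynomial
  \<open>S(x) = \<nu>\<^sub>t ((p(x) - p(t)) / (x - t))\<close> then satisfies
  \<open>D(S / p) = \<nu>(x) + \<nu>(1) x - \<kappa> / p^2\<close> with \<open>\<kappa> = \<nu>(x^(n+1) p)\<close>. As \<open>\<Omega>\<close> is alternating,
  \<open>\<nu>(x) + \<nu>(1) x\<close> is exactly the class of \<open>p(-x)\<close>, so \<open>p(-x) \<sim> \<kappa> / p^2\<close>.

  The value \<open>\<kappa> = (-1)^n n!\<close> comes from deforming \<open>a\<close> to \<open>a - z\<close>. Then
  \<open>W(z) = \<Omega>\<^sub>z(p, x p)\<close> is a Wronskian of solutions of the Laplace transformed differential
  equation, so \<open>z W' = n W\<close>; comparing leading terms gives \<open>W = (-1)^n z^n\<close>, and \<open>\<kappa>\<close> is the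
  \<open>n\<close>-th derivative of \<open>W\<close> at \<open>0\<close>.
\<close>

section \<open>Reduction of polynomials modulo \<open>D\<^sup>- + z\<close>\<close>

definition shift_var :: "complex \<Rightarrow> complex poly" where
  "shift_var a = [:-a, 1:]"

lemma pderiv_shift_var [simp]: "pderiv (shift_var a) = 1"
  by (simp add: shift_var_def pderiv_pCons)

text \<open>
  With \<open>z\<close> the variable of the resulting polynomials, \<open>airy_red a f = (u, v)\<close> means
  \<open>f \<equiv> u(z) + v(z) x\<close> modulo \<open>D\<^sup>- + z\<close>. Multiplication by \<open>x\<close> commutes with \<open>D\<^sup>- + z\<close> only
  after adding \<open>d/dz\<close> (as if everything carried a factor \<open>exp(z x)\<close>), whence the derivatives.
\<close>

definition airy_red :: "complex \<Rightarrow> complex poly \<Rightarrow> complex poly \<times> complex poly" where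
  "airy_red a f =
    fold_coeffs (\<lambda>c (u, v). ([:c:] + pderiv u + shift_var a * v, pderiv v + u)) f (0, 0)"

definition redA :: "complex \<Rightarrow> complex poly \<Rightarrow> complex poly" where
  "redA a f = fst (airy_red a f)"

definition redB :: "complex \<Rightarrow> complex poly \<Rightarrow> complex poly" where
  "redB a f = snd (airy_red a f)"

lemma red_0 [simp]: "redA a 0 = 0" "redB a 0 = 0"
  by (simp_all add: redA_def redB_def airy_red_def)

lemma red_pCons [simp]:
  "redA a (pCons c f) = [:c:] + pderiv (redA a f) + shift_var a * redB a f"
  "redB a (pCons c f) = pderiv (redB a f) + redA a f"
proof -
  let ?F = "\<lambda>c (u, v). ([:c:] + pderiv u + shift_var a * v, pderiv v + u)"
  have "airy_red a (pCons c f) = ?F c (airy_red a f)"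
    by (cases "c = 0 \<and> f = 0") (auto simp: airy_red_def)
  then show "redA a (pCons c f) = [:c:] + pderiv (redA a f) + shift_var a * redB a f"
    "redB a (pCons c f) = pderiv (redB a f) + redA a f"
    by (simp_all add: redA_def redB_def split_beta)
qed

lemma red_add [simp]:
  "redA a (f + g) = redA a f + redA a g" "redB a (f + g) = redB a f + redB a g"
proof -
  have const: "[:b + c:] = [:b:] + [:c:]" for b c :: complex
    by simp
  have "redA a (f + g) = redA a f + redA a g \<and> redB a (f + g) = redB a f + redB a g"
  proof (induction f g rule: poly_induct2)
    case (pCons b f c g)
    then show ?case
      unfolding add_pCons red_pCons const
      by (simp add: pderiv_add algebra_simps del: add_pCons) simp
  qed simp
  then show "redA a (f + g) = redA a f + redA a g" "redB a (f + g) = redB a f + redB a g"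
    by blast+
qed

lemma red_smult [simp]:
  "redA a (smult c f) = smult c (redA a f)" "redB a (smult c f) = smult c (redB a f)"
proof -
  have "redA a (smult c f) = smult c (redA a f) \<and> redB a (smult c f) = smult c (redB a f)"
    by (induction f) (simp_all add: pderiv_smult smult_add_right algebra_simps)
  then show "redA a (smult c f) = smult c (redA a f)" "redB a (smult c f) = smult c (redB a f)"
    by blast+
qed

lemma red_minus [simp]:
  "redA a (- f) = - redA a f" "redB a (- f) = - redB a f"
  using red_smult[of a "-1" f] by simp_all

lemma red_diff [simp]:
  "redA a (f - g) = redA a f - redA a g" "redB a (f - g) = redB a f - redB a g"
  using red_add[of a f "-g"] by simp_all

text \<open>The derivative terms are the commutator of \<open>f(\<nabla>)\<close> with \<open>z\<close>, where \<open>\<nabla> = d/dz + x\<close>.\<close>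

lemma red_twisted:
  "redA a (pCons 0 (pCons 0 f)) = shift_var a * redA a f + redA a (pderiv f)" (is ?A)
  "redB a (pCons 0 (pCons 0 f)) = shift_var a * redB a f + redB a (pderiv f)" (is ?B)
proof -
  have "?A \<and> ?B"
  proof (induction f)
    case (pCons c f)
    then have
      "redA a (pderiv f) = redA a (pCons 0 (pCons 0 f)) - shift_var a * redA a f"
      "redB a (pderiv f) = redB a (pCons 0 (pCons 0 f)) - shift_var a * redB a f"
      by simp_all
    then show ?case
      by (simp add: pderiv_pCons[of c f] pderiv_add pderiv_mult pderiv_diff algebra_simps)
  qed simp
  then show ?A ?B
    by blast+
qed

text \<open>The value at \<open>z = 0\<close> shows that the constant terms annihilate the image of \<open>D\<^sup>-\<close>.\<close>

lemma red_exact: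
  "redA a (pderiv f - [:a, 0, 1:] * f) = - ([:0, 1:] * redA a f)"
  "redB a (pderiv f - [:a, 0, 1:] * f) = - ([:0, 1:] * redB a f)"
proof -
  have eq: "[:a, 0, 1:] * f = smult a f + pCons 0 (pCons 0 f)"
    by simp
  have l: "shift_var a * v = [:0, 1:] * v - smult a v" for v :: "complex poly"
    by (simp add: shift_var_def)
  show "redA a (pderiv f - [:a, 0, 1:] * f) = - ([:0, 1:] * redA a f)"
    "redB a (pderiv f - [:a, 0, 1:] * f) = - ([:0, 1:] * redB a f)"
    unfolding eq red_diff red_add red_smult red_twisted l by simp_all
qed

section \<open>The alternating form \<open>\<Omega>\<close> along the deformation and its value on
  p, x p\<close>

definition red_det :: "complex \<Rightarrow> complex poly \<Rightarrow> complex poly \<Rightarrow> complex poly" where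
  "red_det a f g = redA a f * redB a g - redB a f * redA a g"

text \<open>On coordinates, multiplication by x is d/dz plus the matrix with rows (0, z - a) and (1,
  0). Its trace is zero, so only the Leibniz terms remain.\<close>

lemma pderiv_red_det:
  "pderiv (red_det a f g) = red_det a (pCons 0 f) g + red_det a f (pCons 0 g)"
  by (simp add: red_det_def pderiv_diff pderiv_mult algebra_simps)

lemma red_det_add: "red_det a f (g1 + g2) = red_det a f g1 + red_det a f g2"
  by (simp add: red_det_def algebra_simps)

lemma red_det_smult: "red_det a f (smult c g) = smult c (red_det a f g)"
  by (simp add: red_det_def algebra_simps smult_diff_right)

lemma red_det_exact:
  "red_det a f (pderiv g - [:a, 0, 1:] * g) = - ([:0, 1:] * red_det a f g)"
  unfolding red_det_def red_exact by (simp add: algebra_simps)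

text \<open>To leading order x^2 acts as z, so x^d has top part z^(d/2) or z^((d-1)/2) x according
  to parity.\<close>

lemma red_coeff_top:
  assumes "degree f \<le> d"
  shows "2 * l \<ge> d \<Longrightarrow> coeff (redA a f) l = (if 2 * l = d then coeff f d else 0)"
    and "2 * l + 1 \<ge> d \<Longrightarrow> coeff (redB a f) l = (if 2 * l + 1 = d then coeff f d else 0)"
proof -
  have "(2 * l \<ge> d \<longrightarrow> coeff (redA a f) l = (if 2 * l = d then coeff f d else 0)) \<and>
    (2 * l + 1 \<ge> d \<longrightarrow> coeff (redB a f) l = (if 2 * l + 1 = d then coeff f d else 0))"
    using assms
  proof (induction f arbitrary: d l)
    case (pCons c f)
    show ?case
    proof (cases "f = 0")
      case True
      then show ?thesis by (auto simp: coeff_pCons split: nat.splits)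
    next
      case False
      with pCons.prems obtain e where e: "d = Suc e" "degree f \<le> e"
        by (cases d) auto
      note IH = pCons.IH[OF e(2)]
      show ?thesis
        using IH[of l] IH[of "Suc l"] IH[of "l - 1"]
        by (cases l) (auto simp: e shift_var_def coeff_pderiv)
    qed
  qed auto
  then show "2 * l \<ge> d \<Longrightarrow> coeff (redA a f) l = (if 2 * l = d then coeff f d else 0)"
    and "2 * l + 1 \<ge> d \<Longrightarrow> coeff (redB a f) l = (if 2 * l + 1 = d then coeff f d else 0)"
    by blast+
qed

text \<open>Lagrange identity: the wave operator is formally self-adjoint for the weight exp(-h),
  and the Wronskian of g and p is the explicit primitive.\<close>

lemma wave_exact:
  fixes p g H q :: "complex poly"
  assumes "pderiv (pderiv p) - H * pderiv p + q * p = 0"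
  shows "pderiv (g * pderiv p - pderiv g * p) - H * (g * pderiv p - pderiv g * p) =
    p * (H * pderiv g - pderiv (pderiv g) - q * g)"
proof -
  have "pderiv (pderiv p) = H * pderiv p - q * p"
    using assms by (simp add: algebra_simps add_eq_0_iff2)
  note e = this
  show ?thesis
    by (simp add: pderiv_diff pderiv_mult e algebra_simps)
qed

lemma red_det_wave:
  assumes ode: "pderiv (pderiv p) - [:a, 0, 1:] * pderiv p + [:b, of_nat n:] * p = 0"
    and deg: "degree p = n" and lead: "lead_coeff p = 1"
  shows "red_det a p (pCons 0 p) = monom ((-1) ^ n) n"
proof -
  define W where "W = red_det a p (pCons 0 p)"
  have self: "red_det a p p = 0"
    by (simp add: red_det_def)
  have "pderiv (pderiv p) - [:a, 0, 1:] * pderiv p = - (smult b p + smult (of_nat n) (pCons 0 p))"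
    using ode unfolding add_eq_0_iff2 by simp
  then have "red_det a p (pderiv (pderiv p) - [:a, 0, 1:] * pderiv p) =
      red_det a p (smult (-b) p + smult (- of_nat n) (pCons 0 p))"
    by simp
  \<comment> \<open>Pairing p with \<open>D\<^sup>- (pderiv p)\<close> produces the factor
    z.\<close>
  then have 1: "smult (of_nat n) W = [:0, 1:] * red_det a p (pderiv p)"
    unfolding red_det_exact red_det_add red_det_smult self W_def[symmetric]
    by (simp only: smult_0_right smult_minus_left add_0_left neg_equal_iff_equal)
  \<comment> \<open>Replacing p' by a p + x^2 p costs only a multiple of
    \<open>red_det a p p = 0\<close>. The pairing of p with x^2 p is W', since x p pairs to zero
    with itself.\<close>
  have "pderiv p = (pderiv p - [:a, 0, 1:] * p) + (smult a p + smult 1 (pCons 0 (pCons 0 p)))"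
    by simp
  then have "red_det a p (pderiv p) = red_det a p \<dots>"
    by simp
  also have "\<dots> = red_det a p (pCons 0 (pCons 0 p))"
    unfolding red_det_exact red_det_add red_det_smult self by simp
  also have "\<dots> = pderiv W"
    unfolding W_def pderiv_red_det by (simp add: red_det_def)
  finally have 2: "smult (of_nat n) W = [:0, 1:] * pderiv W"
    using 1 by simp
  have off: "coeff W k = 0" if "k \<noteq> n" for k
  proof -
    have "of_nat n * coeff W k = of_nat k * coeff W k"
      using arg_cong[OF 2, of "\<lambda>q. coeff q k"]
      by (cases k) (simp_all add: coeff_pderiv)
    with that show ?thesis
      by simp
  qed
  have coeff_n: "coeff p n = 1"
    using deg lead by simp
  have dp: "degree p \<le> n" and dxp: "degree (pCons 0 p) \<le> Suc n"
    using deg degree_pCons_le[of 0 p] by simp_all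
  \<comment> \<open>In the coefficient of z^n only a product of two top coefficients survives: in A
    B for even n, in B A for odd n. This is the source of the sign.\<close>
  have AB: "coeff (redA a p) i * coeff (redB a (pCons 0 p)) (n - i) = (if 2 * i = n then 1 else 0)"
    if "i \<le> n" for i
    using that red_coeff_top(1)[OF dp, of i a] red_coeff_top(2)[OF dxp, of "n - i" a] coeff_n
    by (cases "2 * i \<ge> n") (auto simp del: red_pCons)
  have BA: "coeff (redB a p) i * coeff (redA a (pCons 0 p)) (n - i) = (if 2 * i + 1 = n then 1 else 0)"
    if "i \<le> n" for i
    using that red_coeff_top(2)[OF dp, of i a] red_coeff_top(1)[OF dxp, of "n - i" a] coeff_n
    by (cases "2 * i + 1 \<ge> n") (auto simp del: red_pCons)
  have "coeff W n = (\<Sum>i\<le>n. if 2 * i = n then 1 else 0) - (\<Sum>i\<le>n. if 2 * i + 1 = n then 1 else 0)"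
    unfolding W_def red_det_def coeff_diff coeff_mult using AB BA by simp
  also have "\<dots> = (-1) ^ n"
  proof (cases "even n")
    case True
    then obtain m where m: "n = 2 * m" ..
    have "(\<Sum>i\<le>n. if 2 * i = n then 1 else 0) = (\<Sum>i\<le>n. if i = m then 1 else 0 :: complex)"
      "(\<Sum>i\<le>n. if 2 * i + 1 = n then 1 else 0) = (\<Sum>i\<le>n. 0 :: complex)"
      using m by (intro sum.cong; auto; presburger)+
    with m show ?thesis by simp
  next
    case False
    then obtain m where m: "n = 2 * m + 1" ..
    have "(\<Sum>i\<le>n. if 2 * i = n then 1 else 0) = (\<Sum>i\<le>n. 0 :: complex)"
      "(\<Sum>i\<le>n. if 2 * i + 1 = n then 1 else 0) = (\<Sum>i\<le>n. if i = m then 1 else 0 :: complex)"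
      using m by (intro sum.cong; auto; presburger)+
    with m show ?thesis by simp
  qed
  finally show ?thesis
    using off by (intro poly_eqI) (auto simp: W_def)
qed

section \<open>Linear forms killing the image of \<open>D\<^sup>-\<close>, and the moments of
  p\<close>

locale linear_form =
  fixes l :: "complex poly \<Rightarrow> complex"
  assumes add: "l (f + g) = l f + l g"
    and smult: "l (smult c f) = c * l f"
begin

lemma zero [simp]: "l 0 = 0"
  using smult[of 0 0] by simp

lemma minus: "l (- f) = - l f"
  using smult[of "-1" f] by simp

lemma diff: "l (f - g) = l f - l g"
  using add[of f "- g"] by (simp add: minus)

end

text \<open>Used for the two coordinates at z = 0 and for the pairing with p.\<close>

locale exact_form = linear_form +
  fixes a :: complex
  assumes exact: "l (pderiv f - [:a, 0, 1:] * f) = 0"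
begin

text \<open>\<open>X\<close> and \<open>Y\<close> obey the same recurrence: for \<open>X\<close> by
  the Lagrange identity with g = x^k, for \<open>Y\<close> by comparing coefficients in the
  equation. The factor n - k is nonzero for k < n, so both are fixed by their initial
  values.\<close>

lemma wave_moments:
  assumes ode: "pderiv (pderiv p) - [:a, 0, 1:] * pderiv p + [:b, of_nat n:] * p = 0"
    and deg: "degree p = n" and lead: "lead_coeff p = 1" and "k \<le> n"
  shows "l (monom 1 k * p) = fact k * fact (n - k) * coeff p (n - k) / fact n * l p"
proof -
  define X where "X k = l (monom 1 k * p)" for k
  define Y where "Y k = fact k * fact (n - k) * coeff p (n - k)" for k
  have X_rec: "(of_nat n - of_nat k) * X (Suc k) =
      - b * X k + a * of_nat k * X (k - 1) - of_nat k * of_nat (k - 1) * X (k - 2)" for k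
  proof -
    define g where "g = (monom 1 k :: complex poly)"
    have "l (p * ([:a, 0, 1:] * pderiv g - pderiv (pderiv g) - [:b, of_nat n:] * g)) = 0"
      using exact unfolding wave_exact[OF ode, symmetric] .
    moreover have "[:a, 0, 1:] * pderiv g =
        Polynomial.smult (a * of_nat k) (monom 1 (k - 1)) +
        Polynomial.smult (of_nat k) (monom 1 (Suc k))"
      by (cases k) (simp_all add: g_def pderiv_monom smult_monom, simp add: monom_Suc)
    moreover have "pderiv (pderiv g) =
        Polynomial.smult (of_nat k * of_nat (k - 1)) (monom 1 (k - 2))"
      by (simp add: g_def pderiv_monom smult_monom numeral_2_eq_2)
    moreover have "[:b, of_nat n:] * g =
        Polynomial.smult b (monom 1 k) + Polynomial.smult (of_nat n) (monom 1 (Suc k))"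
      by (simp add: g_def monom_Suc)
    ultimately have "0 = l (p * (Polynomial.smult (a * of_nat k) (monom 1 (k - 1)) +
        Polynomial.smult (of_nat k) (monom 1 (Suc k)) -
        Polynomial.smult (of_nat k * of_nat (k - 1)) (monom 1 (k - 2)) -
        (Polynomial.smult b (monom 1 k) + Polynomial.smult (of_nat n) (monom 1 (Suc k)))))"
      by simp
    also have "\<dots> = a * of_nat k * X (k - 1) + of_nat k * X (Suc k) -
        of_nat k * of_nat (k - 1) * X (k - 2) - (b * X k + of_nat n * X (Suc k))"
      unfolding X_def mult.commute[of _ p] right_diff_distrib distrib_left mult_smult_right
      by (simp add: add diff smult)
    finally show ?thesis
      by (simp add: algebra_simps)
  qed
  have Y_rec: "(of_nat n - of_nat k) * Y (Suc k) =
      - b * Y k + a * of_nat k * Y (k - 1) - of_nat k * of_nat (k - 1) * Y (k - 2)" if "k < n" for k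
  proof -
    obtain r where r: "n = Suc (r + k)"
      using less_imp_Suc_add[OF \<open>k < n\<close>] by (auto simp: add.commute)
    have "0 = coeff (pderiv (pderiv p) - [:a, 0, 1:] * pderiv p + [:b, of_nat n:] * p) (Suc r)"
      unfolding ode by simp
    also have "\<dots> = of_nat (r + 2) * of_nat (r + 3) * coeff p (r + 3)
        - (a * of_nat (r + 2) * coeff p (r + 2) + of_nat r * coeff p r)
        + (b * coeff p (Suc r) + of_nat n * coeff p r)"
    proof -
      have "coeff (pderiv (pderiv p)) (Suc r) = of_nat (r + 2) * of_nat (r + 3) * coeff p (r + 3)"
        by (simp add: coeff_pderiv numeral_3_eq_3)
      moreover have "coeff ([:a, 0, 1:] * pderiv p) (Suc r) =
          a * of_nat (r + 2) * coeff p (r + 2) + of_nat r * coeff p r"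
        by (cases r) (simp_all add: coeff_pderiv)
      moreover have "coeff ([:b, of_nat n:] * p) (Suc r) = b * coeff p (Suc r) + of_nat n * coeff p r"
        by simp
      ultimately show ?thesis
        by (simp only: coeff_add coeff_diff)
    qed
    also have "(of_nat n :: complex) = of_nat (Suc k) + of_nat r"
      unfolding r of_nat_add[symmetric] by simp
    finally have c: "of_nat (Suc k) * coeff p r = a * (of_nat (r + 2) * coeff p (r + 2))
        - of_nat (r + 2) * of_nat (r + 3) * coeff p (r + 3) - b * coeff p (Suc r)"
      by (simp add: algebra_simps)
    \<comment> \<open>Where k - 1 or k - 2 is truncated, the left factor is zero and the coefficient
      on the right lies above degree n.\<close>
    have 1: "of_nat k * Y (k - 1) = fact k * fact (Suc r) * (of_nat (r + 2) * coeff p (r + 2))"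
    proof (cases k)
      case 0
      then have "coeff p (r + 2) = 0"
        using deg r by (intro coeff_eq_0) simp
      with 0 show ?thesis by simp
    next
      case (Suc j)
      with r have "n - j = r + 2"
        by simp
      with Suc show ?thesis
        by (simp add: Y_def algebra_simps numeral_2_eq_2)
    qed
    have 2: "of_nat k * of_nat (k - 1) * Y (k - 2) =
        fact k * fact (Suc r) * (of_nat (r + 2) * of_nat (r + 3) * coeff p (r + 3))"
    proof (cases "k < 2")
      case True
      then have "coeff p (r + 3) = 0"
        using deg r by (intro coeff_eq_0) simp
      with True show ?thesis by (cases k) auto
    next
      case False
      then obtain j where j: "k = Suc (Suc j)"
        by (metis add_2_eq_Suc le_Suc_ex not_less)
      with r have "n - j = r + 3"
        by simp
      with j show ?thesis
        by (simp add: Y_def algebra_simps numeral_2_eq_2 numeral_3_eq_3)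
    qed
    have "(of_nat n - of_nat k) * Y (Suc k) = fact k * fact (Suc r) * (of_nat (Suc k) * coeff p r)"
      by (simp add: Y_def r algebra_simps)
    also have "\<dots> = - b * Y k + a * (of_nat k * Y (k - 1)) - of_nat k * of_nat (k - 1) * Y (k - 2)"
      unfolding c 1 2 by (simp add: Y_def r algebra_simps)
    finally show ?thesis
      by simp
  qed
  have "k \<le> n \<Longrightarrow> fact n * X k = Y k * X 0" for k
  proof (induction k rule: less_induct)
    case (less k)
    show ?case
    proof (cases k)
      case 0
      then show ?thesis using deg lead by (simp add: Y_def)
    next
      case (Suc j)
      have IH: "fact n * X i = Y i * X 0" if "i \<le> j" for i
        using less that Suc by simp
      have "(of_nat n - of_nat j) * (fact n * X k) =
        - b * (fact n * X j) + a * of_nat j * (fact n * X (j - 1))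
          - of_nat j * of_nat (j - 1) * (fact n * X (j - 2))"
        using arg_cong[OF X_rec[of j], of "\<lambda>x. fact n * x"] Suc by (simp add: algebra_simps)
      also have "\<dots> = (of_nat n - of_nat j) * (Y k * X 0)"
        using arg_cong[OF Y_rec[of j], of "\<lambda>x. x * X 0"] IH[of j] IH[of "j - 1"] IH[of "j - 2"]
          Suc less.prems by (simp add: algebra_simps)
      finally show ?thesis
        using Suc less.prems by simp
    qed
  qed
  then show ?thesis
    using \<open>k \<le> n\<close> by (simp add: X_def Y_def nonzero_eq_divide_eq mult.commute[of _ "fact n"])
qed

end

section \<open>The associated polynomial S and the identity for D(S / p)\<close>

text \<open>This is \<open>l\<^sub>t ((f(x) - f(t)) / (x - t))\<close>, the form \<open>l\<close> acting on the variable \<open>t\<close>.\<close>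

definition second_kind :: "(complex poly \<Rightarrow> complex) \<Rightarrow> complex poly \<Rightarrow> complex poly" where
  "second_kind l f = Poly (map (\<lambda>j. l (poly_shift (Suc j) f)) [0..<degree f])"

context linear_form
begin

lemma coeff_second_kind: "coeff (second_kind l f) j = l (poly_shift (Suc j) f)"
proof -
  have "poly_shift (Suc j) f = 0" if "j \<ge> degree f"
    using that by (auto simp: poly_eq_iff coeff_poly_shift intro: coeff_eq_0)
  then show ?thesis
    by (simp add: second_kind_def coeff_Poly_eq nth_default_def)
qed

lemma second_kind_0 [simp]: "second_kind l 0 = 0"
  by (simp add: second_kind_def)

lemma second_kind_pCons [simp]: "second_kind l (pCons c f) = pCons (l f) (second_kind l f)"
proof (rule poly_eqI)
  fix j
  have "poly_shift (Suc i) (pCons c f) = poly_shift i f" for i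
    by (simp add: poly_eq_iff coeff_poly_shift)
  moreover have "poly_shift 0 f = f"
    by (simp add: poly_eq_iff coeff_poly_shift)
  ultimately show "coeff (second_kind l (pCons c f)) j = coeff (pCons (l f) (second_kind l f)) j"
    by (cases j) (simp_all add: coeff_second_kind)
qed

lemma second_kind_add: "second_kind l (f + g) = second_kind l f + second_kind l g"
  by (induction f g rule: poly_induct2) (simp_all add: add)

lemma second_kind_smult: "second_kind l (Polynomial.smult c f) = Polynomial.smult c (second_kind l f)"
  by (induction f) (simp_all add: smult)

lemma linear_form_mult: "linear_form (\<lambda>f. l (g * f))"
  by unfold_locales (simp_all add: distrib_left add smult)

text \<open>Leibniz rule for divided differences: p(x) g(x) - p(t) g(t) = p(x) (g(x) - g(t)) + g(t)
  (p(x) - p(t)).\<close>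

lemma second_kind_mult:
  "second_kind l (p * g) = p * second_kind l g + second_kind (\<lambda>f. l (g * f)) p"
proof (induction p)
  case (pCons c p)
  interpret gl: linear_form "\<lambda>f. l (g * f)"
    by (rule linear_form_mult)
  show ?case
    using pCons by (simp add: second_kind_add second_kind_smult mult.commute[of g p])
qed (simp add: linear_form.second_kind_0[OF linear_form_mult])

text \<open>The divided difference of f has degree less than \<open>degree f\<close> in t.\<close>

lemma second_kind_eq_0:
  assumes "\<And>f. degree f < d \<Longrightarrow> l f = 0" and "degree f \<le> d"
  shows "second_kind l f = 0"
  using assms(2)
proof (induction f)
  case (pCons c f)
  then show ?case
    using assms(1)[of f] by (cases "f = 0") auto
qed simp

lemma sum: "l (\<Sum>i\<in>I. f i) = (\<Sum>i\<in>I. l (f i))"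
  by (induction I rule: infinite_finite_induct) (simp_all add: add)

lemma orthogonal_top:
  assumes "\<And>k. k \<le> n \<Longrightarrow> l (monom 1 k * p) = 0" and "degree f \<le> Suc n"
  shows "l (p * f) = coeff f (Suc n) * l (monom 1 (Suc n) * p)"
proof -
  have "p * f = (\<Sum>i\<le>Suc n. Polynomial.smult (coeff f i) (monom 1 i * p))"
  proof -
    have "p * f = (\<Sum>i\<le>Suc n. monom (coeff f i) i) * p"
      unfolding poly_as_sum_of_monoms'[OF assms(2)] by (rule mult.commute)
    then show ?thesis
      by (simp only: sum_distrib_right mult_smult_left[symmetric] smult_monom mult_1_right)
  qed
  then have "l (p * f) = (\<Sum>i\<le>Suc n. coeff f i * l (monom 1 i * p))"
    by (simp only: sum smult)
  also have "\<dots> = coeff f (Suc n) * l (monom 1 (Suc n) * p)"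
    using assms(1) by (simp add: sum.neutral)
  finally show ?thesis .
qed

end

context exact_form
begin

text \<open>Let F be the divided difference of f. Then d/dx + d/dt maps F to that of f', exactness
  trades d/dt for h'(t), and h'(x) - h'(t) = (x - t) (x + t) leaves l applied to (x + t) (f(x) -
  f(t)).\<close>

lemma second_kind_deriv:
  "pderiv (second_kind l f) + [:a, 0, 1:] * second_kind l f =
    second_kind l (pderiv f) + [:l [:0, 1:], l 1:] * f - [:l (pCons 0 f), l f:]"
proof (induction f)
  case (pCons c f)
  define S S' M where "S = second_kind l f" and "S' = second_kind l (pderiv f)"
    and "M = [:l [:0, 1:], l 1:] * f"
  have moment: "l (pderiv f) = a * l f + l (pCons 0 (pCons 0 f))"
    using exact[of f] by (simp add: diff add smult)
  have "pCons c f = Polynomial.smult c 1 + pCons 0 f"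
    "pCons 0 (pCons c f) = Polynomial.smult c [:0, 1:] + pCons 0 (pCons 0 f)"
    by simp_all
  then have moments: "l (pCons c f) = c * l 1 + l (pCons 0 f)"
    "l (pCons 0 (pCons c f)) = c * l [:0, 1:] + l (pCons 0 (pCons 0 f))"
    by (simp_all only: add smult)
  have "pderiv (second_kind l (pCons c f)) + [:a, 0, 1:] * second_kind l (pCons c f) =
      S + [:a * l f, 0, l f:] + pCons 0 (pderiv S + [:a, 0, 1:] * S)"
    by (simp add: pderiv_pCons S_def algebra_simps)
  also have "pderiv S + [:a, 0, 1:] * S = S' + M - [:l (pCons 0 f), l f:]"
    using pCons by (simp only: S_def S'_def M_def)
  also have "S + [:a * l f, 0, l f:] + pCons 0 (S' + M - [:l (pCons 0 f), l f:]) =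
      (S + pCons (l (pderiv f)) S') + ([:c * l [:0, 1:], c * l 1:] + pCons 0 M) -
      [:l (pCons 0 (pCons c f)), l (pCons c f):]"
    unfolding moments moment
    by (rule poly_eqI) (auto simp: coeff_pCons split: nat.splits)
  also have "S + pCons (l (pderiv f)) S' = second_kind l (pderiv (pCons c f))"
    by (simp add: pderiv_pCons second_kind_add S_def S'_def)
  also have "[:c * l [:0, 1:], c * l 1:] + pCons 0 M = [:l [:0, 1:], l 1:] * pCons c f"
    by (simp add: M_def mult.commute)
  finally show ?case .
qed simp

lemma second_kind_wronskian:
  assumes deg: "degree p = n" and lead: "lead_coeff p = 1"
    and orth: "\<And>k. k \<le> n \<Longrightarrow> l (monom 1 k * p) = 0"
  shows "pderiv (second_kind l p) * p - second_kind l p * pderiv p +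
      [:a, 0, 1:] * second_kind l p * p =
    p ^ 2 * [:l [:0, 1:], l 1:] - [:l (monom 1 (Suc n) * p):]"
proof -
  define \<kappa> where "\<kappa> = l (monom 1 (Suc n) * p)"
  define S where "S = second_kind l p"
  have top: "l (p * f) = coeff f (Suc n) * \<kappa>" if "degree f \<le> Suc n" for f
    using orthogonal_top[OF orth that] by (simp add: \<kappa>_def)
  interpret pl: linear_form "\<lambda>f. l (p * f)"
    by (rule linear_form_mult)
  interpret p'l: linear_form "\<lambda>f. l (pderiv p * f)"
    by (rule linear_form_mult)
  \<comment> \<open>Expanding \<open>second_kind l (p * pderiv p)\<close> in the two possible orders.\<close>
  have "p * second_kind l (pderiv p) + second_kind (\<lambda>f. l (pderiv p * f)) p =
      pderiv p * S + second_kind (\<lambda>f. l (p * f)) (pderiv p)"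
    unfolding S_def second_kind_mult[symmetric] by (simp add: mult.commute)
  also have "second_kind (\<lambda>f. l (p * f)) (pderiv p) = 0"
    using deg degree_pderiv[of p] top
    by (intro pl.second_kind_eq_0[of n]) (simp_all add: coeff_eq_0)
  finally have swap: "p * second_kind l (pderiv p) =
      pderiv p * S - second_kind (\<lambda>f. l (pderiv p * f)) p"
    by (simp add: algebra_simps)
  \<comment> \<open>For n = 0 the constant comes from the second summand, otherwise from the
    first.\<close>
  have "second_kind (\<lambda>f. l (pderiv p * f)) p + p * [:l (pCons 0 p), l p:] = [:\<kappa>:]"
  proof (cases n)
    case 0
    then have "p = 1"
      using deg lead by (metis degree_eq_zeroE coeff_pCons_0 one_pCons)
    with 0 orth[of 0] show ?thesis
      by (simp add: \<kappa>_def second_kind_def monom_Suc)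
  next
    case (Suc m)
    obtain c q where p: "p = pCons c q"
      by (cases p)
    with deg lead Suc have q: "degree q = m" "coeff q m = 1"
      by (auto split: if_splits)
    \<comment> \<open>By parts, p' f becomes p (h' f - f'), two degrees higher than f, so only the
      coefficient at m + 2 = n + 1 contributes.\<close>
    have dual: "l (pderiv p * f) = coeff f m * \<kappa>" if "degree f \<le> m" for f
    proof -
      have "pderiv p * f = (pderiv (p * f) - [:a, 0, 1:] * (p * f)) + p * ([:a, 0, 1:] * f - pderiv f)"
        by (simp add: pderiv_mult algebra_simps)
      then have "l (pderiv p * f) = l (p * ([:a, 0, 1:] * f - pderiv f))"
        by (simp only: add exact) simp
      also have "\<dots> = coeff f m * \<kappa>"
      proof -
        have "degree ([:a, 0, 1:] * f) \<le> 2 + m"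
          using degree_mult_le[of "[:a, 0, 1:]" f] that by simp
        moreover have "degree (pderiv f) \<le> 2 + m"
          using degree_pderiv[of f] that by simp
        ultimately have "degree ([:a, 0, 1:] * f - pderiv f) \<le> Suc n"
          using Suc by (intro degree_diff_le) simp_all
        moreover have "coeff ([:a, 0, 1:] * f - pderiv f) (Suc n) = coeff f m"
          using that Suc by (simp add: coeff_pderiv coeff_eq_0)
        ultimately show ?thesis
          using top by simp
      qed
      finally show ?thesis .
    qed
    have "second_kind (\<lambda>f. l (pderiv p * f)) q = 0"
      using q dual by (intro p'l.second_kind_eq_0[of m]) (simp_all add: coeff_eq_0)
    moreover have "l (pderiv p * q) = \<kappa>"
      using dual[of q] q by simp
    ultimately have "second_kind (\<lambda>f. l (pderiv p * f)) p = [:\<kappa>:]"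
      unfolding p p'l.second_kind_pCons[unfolded p] by simp
    moreover have "l p = 0" "l (pCons 0 p) = 0"
      using orth[of 0] orth[of 1] Suc by (simp_all add: monom_Suc)
    ultimately show ?thesis
      by simp
  qed
  moreover have "pderiv S * p - S * pderiv p + [:a, 0, 1:] * S * p =
      p * (pderiv S + [:a, 0, 1:] * S) - pderiv p * S"
    by (simp add: algebra_simps)
  moreover have "p * (pderiv S + [:a, 0, 1:] * S) = p * second_kind l (pderiv p) +
      p ^ 2 * [:l [:0, 1:], l 1:] - p * [:l (pCons 0 p), l p:]"
    unfolding S_def second_kind_deriv by (simp only: distrib_left right_diff_distrib power2_eq_square ac_simps)
  ultimately show ?thesis
    unfolding swap S_def[symmetric] \<kappa>_def[symmetric] by (simp only: algebra_simps)
qed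

end

section \<open>Normal forms modulo \<open>D\<^sup>-\<close>, and the constant \<kappa>\<close>

text \<open>Leading terms are removed by images of monomials. The remainder is identified by
  \<open>red_exact\<close> at z = 0.\<close>

lemma reduction:
  "\<exists>T. f = pderiv T - [:a, 0, 1:] * T + [:coeff (redA a f) 0, coeff (redB a f) 0:]"
proof -
  have "\<exists>T c d. f = pderiv T - [:a, 0, 1:] * T + [:c, d:]"
  proof (induction "degree f" arbitrary: f rule: less_induct)
    case less
    show ?case
    proof (cases "degree f < 2")
      case True
      then have "f = pderiv 0 - [:a, 0, 1:] * 0 + [:coeff f 0, coeff f 1:]"
        by (auto simp: poly_eq_iff coeff_pCons coeff_eq_0 split: nat.splits)
      then show ?thesis by blast
    next
      case False
      then obtain d where d: "degree f = Suc (Suc d)"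
        by (metis add_2_eq_Suc le_Suc_ex not_less)
      define g where "g = monom (lead_coeff f) d"
      define f2 where "f2 = f + (pderiv g - [:a, 0, 1:] * g)"
      have "coeff f2 i = 0" if "i \<ge> Suc (Suc d)" for i
      proof -
        have "[:a, 0, 1:] * g = smult a g + monom (lead_coeff f) (Suc (Suc d))"
          by (simp add: g_def monom_Suc)
        with that d show ?thesis
          by (cases "i = Suc (Suc d)") (auto simp: f2_def g_def coeff_pderiv coeff_eq_0)
      qed
      then have "degree f2 < degree f"
        using d by (metis degree_0 leading_coeff_0_iff not_less zero_less_Suc)
      from less[OF this] obtain T c e where "f2 = pderiv T - [:a, 0, 1:] * T + [:c, e:]"
        by blast
      moreover have "f = f2 - (pderiv g - [:a, 0, 1:] * g)"
        by (simp only: f2_def add_diff_cancel_right')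
      ultimately have "f = pderiv (T - g) - [:a, 0, 1:] * (T - g) + [:c, e:]"
        unfolding pderiv_diff right_diff_distrib
        by (simp only: diff_conv_add_uminus minus_add_distrib minus_minus ac_simps)
      then show ?thesis by blast
    qed
  qed
  then obtain T c d where T: "f = pderiv T - [:a, 0, 1:] * T + [:c, d:]"
    by blast
  have c: "coeff (redA a f) 0 = c" and d: "coeff (redB a f) 0 = d"
    unfolding T red_add red_exact by (simp_all add: pderiv_pCons)
  show ?thesis
    unfolding c d using T by blast
qed

lemma wave_degree:
  assumes ode: "pderiv (pderiv p) - [:a, 0, 1:] * pderiv p + [:b, of_nat n:] * p = 0"
    and "p \<noteq> (0 :: complex poly)"
  shows "degree p = n"
proof -
  define d where "d = degree p"
  have "0 = coeff (pderiv (pderiv p) - [:a, 0, 1:] * pderiv p + [:b, of_nat n:] * p) (Suc d)"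
    unfolding ode by simp
  also have "\<dots> = (of_nat n - of_nat d) * lead_coeff p"
    by (cases d) (simp_all add: coeff_pderiv coeff_eq_0 d_def algebra_simps)
  finally show ?thesis
    using assms(2) by (simp add: d_def)
qed

interpretation redA0: exact_form "\<lambda>f. coeff (redA a f) 0" a for a
  by unfold_locales (simp_all only: red_add red_smult red_exact, simp_all)

interpretation redB0: exact_form "\<lambda>f. coeff (redB a f) 0" a for a
  by unfold_locales (simp_all only: red_add red_smult red_exact, simp_all)

lemma red_det_exact_form: "exact_form (\<lambda>g. coeff (red_det a p g) 0) a"
  by unfold_locales (simp_all only: red_det_add red_det_smult red_det_exact, simp_all)

text \<open>At z = 0 the classes of x^k p with k \<le> n are all proportional to that of p. In the
  n-th derivative of \<open>w 0 1\<close> every Leibniz term but \<open>w 0 (Suc n)\<close> has both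
  indices at most n.\<close>

lemma wave_norm:
  assumes ode: "pderiv (pderiv p) - [:a, 0, 1:] * pderiv p + [:b, of_nat n:] * p = 0"
    and deg: "degree p = n" and lead: "lead_coeff p = 1"
  defines "w \<equiv> \<lambda>i j. red_det a (monom 1 i * p) (monom 1 j * p)"
  shows "\<lbrakk>i \<le> n; j \<le> n\<rbrakk> \<Longrightarrow> coeff (w i j) 0 = 0"
    and "coeff (w 0 (Suc n)) 0 = (-1) ^ n * fact n"
proof -
  show zero: "coeff (w i j) 0 = 0" if "i \<le> n" "j \<le> n" for i j
  proof -
    have proportional: "\<exists>t. coeff (redA a (monom 1 k * p)) 0 = t * coeff (redA a p) 0 \<and>
        coeff (redB a (monom 1 k * p)) 0 = t * coeff (redB a p) 0" if "k \<le> n" for k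
      using redA0.wave_moments[OF ode deg lead that] redB0.wave_moments[OF ode deg lead that]
      by blast
    show ?thesis
      using proportional[OF that(1)] proportional[OF that(2)] unfolding w_def red_det_def
      by (auto simp: coeff_mult_0)
  qed
  have deriv: "pderiv (w i j) = w (Suc i) j + w i (Suc j)" for i j
    by (simp add: w_def pderiv_red_det monom_Suc)
  have inner: "coeff ((pderiv ^^ m) (w (Suc i) (Suc j))) 0 = 0" if "i + j + m < n" for i j m
    using that
    by (induction m arbitrary: i j) (simp_all add: funpow_Suc_right deriv higher_pderiv_add zero del: funpow.simps(2))
  have outer: "coeff ((pderiv ^^ m) (w 0 (Suc j))) 0 = coeff (w 0 (Suc n)) 0" if "j + m = n" for j m
    using that
  proof (induction m arbitrary: j)
    case (Suc m)
    then show ?case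
      using inner[of 0 j m]
      by (simp add: funpow_Suc_right deriv higher_pderiv_add del: funpow.simps(2))
  qed simp
  have "w 0 (Suc 0) = monom ((-1) ^ n) n"
    using red_det_wave[OF ode deg lead] by (simp add: w_def monom_Suc)
  then show "coeff (w 0 (Suc n)) 0 = (-1) ^ n * fact n"
    using outer[of 0 n] by (simp add: coeff_higher_pderiv pochhammer_fact mult.commute)
qed

section \<open>Reflection and the final primitive\<close>

lemma reflect_arg_simps:
  "reflect_arg (f + g) = reflect_arg f + reflect_arg g"
  "reflect_arg (f - g) = reflect_arg f - reflect_arg g"
  "reflect_arg (f * g) = reflect_arg f * reflect_arg g"
  "reflect_arg (smult c f) = smult c (reflect_arg f)"
  "reflect_arg (pderiv f) = - pderiv (reflect_arg f)"
  by (simp_all add: reflect_arg_def pcompose_add pcompose_diff pcompose_mult pcompose_smult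
      pderiv_pcompose pderiv_pCons)

text \<open>As h' is even, reflection turns \<open>D\<^sup>-\<close> into -D.\<close>

lemma reflect_arg_exact:
  "reflect_arg (pderiv T - [:a, 0, 1:] * T) =
    - (pderiv (reflect_arg T) + [:a, 0, 1:] * reflect_arg T)"
proof -
  have "reflect_arg [:a, 0, 1:] = [:a, 0, 1:]"
    by (simp add: reflect_arg_def pcompose_pCons)
  then show ?thesis
    by (simp only: reflect_arg_simps) simp
qed

lemma D_map_Fract:
  assumes "p \<noteq> 0"
  shows "D_map h (Fract r p) = Fract (pderiv r * p - r * pderiv p + pderiv h * r * p) (p ^ 2)"
  using assms
  by (simp add: D_map_def fract_deriv_Fract to_fract_def eq_fract power2_eq_square algebra_simps)

theorem theorem7p1:
  fixes a :: complex and h p :: "complex poly" and n :: nat and c :: "nat \<Rightarrow> complex"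
  assumes "h = [:0, a, 0, 1/3:]"
    and "wave_poly h n p"
    and "lead_coeff p = 1"
    and "p = (\<Sum>s\<le>n. smult (c s) (exp_monom s))"
  shows "\<forall>k\<le>n. D_equiv h
      (to_fract (reflect_arg (exp_monom k) * reflect_arg p))
      (to_fract [:(-1)^n * c (n - k):] / (to_fract p)^2)"
proof (intro allI impI)
  fix k assume k: "k \<le> n"
  define H where "H = [:a, 0, 1:]"
  have h: "pderiv h = [:a, 0, 1:]"
    using assms(1) by (simp add: pderiv_pCons)
  obtain b where ode: "pderiv (pderiv p) - [:a, 0, 1:] * pderiv p + [:b, of_nat n:] * p = 0"
    and p0: "p \<noteq> 0"
    using assms(2) unfolding wave_poly_def h by blast
  have deg: "degree p = n"
    using wave_degree[OF ode p0] .
  note lead = assms(3)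
  have coeff_p: "coeff p s = c s / fact s" if "s \<le> n" for s
  proof -
    have "coeff p s = (\<Sum>i\<le>n. c i * (if i = s then 1 / fact i else 0))"
      by (subst assms(4)) (simp add: coeff_sum exp_monom_def)
    also have "\<dots> = (\<Sum>i\<le>n. if i = s then c i / fact i else 0)"
      by (intro sum.cong) auto
    finally show ?thesis
      using that by simp
  qed
  define P where "P = reflect_arg p"
  define \<kappa> :: complex where "\<kappa> = (-1) ^ n * fact n"
  define t where "t = c (n - k) / fact n"

  \<comment> \<open>This says D(r0 / p) = P - \<kappa> / p^2.\<close>
  obtain r0 where r0: "pderiv r0 * p - r0 * pderiv p + H * r0 * p = p ^ 2 * P - [:\<kappa>:]"
  proof -
    interpret exact_form "\<lambda>g. coeff (red_det a p g) 0" a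
      by (rule red_det_exact_form)
    define S where "S = second_kind (\<lambda>g. coeff (red_det a p g) 0) p"
    \<comment> \<open>The pairing of p with 1 and x swaps the coordinates up to sign, so R is the
      reflected normal form of p.\<close>
    define R where "R = [:coeff (redA a p) 0, - coeff (redB a p) 0:]"
    have "coeff (red_det a p (monom 1 i * p)) 0 = 0" if "i \<le> n" for i
      using wave_norm(1)[OF ode deg lead, of 0 i] that by simp
    from second_kind_wronskian[OF deg lead this]
    have S: "pderiv S * p - S * pderiv p + H * S * p = p ^ 2 * R - [:\<kappa>:]"
      using wave_norm(2)[OF ode deg lead]
      by (simp add: S_def R_def H_def \<kappa>_def red_det_def one_pCons coeff_mult_0)
    obtain T where T: "p = pderiv T - [:a, 0, 1:] * T + [:coeff (redA a p) 0, coeff (redB a p) 0:]"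
      using reduction by blast
    define Q where "Q = reflect_arg T"
    have "reflect_arg [:coeff (redA a p) 0, coeff (redB a p) 0:] = R"
      by (simp add: R_def reflect_arg_def pcompose_pCons)
    then have P: "P = - (pderiv Q + H * Q) + R"
      unfolding P_def Q_def H_def by (subst T) (simp only: reflect_arg_simps(1) reflect_arg_exact)
    have "pderiv (S - Q * p) * p - (S - Q * p) * pderiv p + H * (S - Q * p) * p =
        (pderiv S * p - S * pderiv p + H * S * p) - p ^ 2 * (pderiv Q + H * Q)"
      by (simp add: pderiv_diff pderiv_mult algebra_simps power2_eq_square)
    also have "\<dots> = p ^ 2 * P - [:\<kappa>:]"
      unfolding S P by (simp add: algebra_simps)
    finally show ?thesis
      by (rule that)
  qed

  \<comment> \<open>The classes of e_k p and t p agree, as both coordinates of the difference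
    vanish.\<close>
  obtain T where T: "exp_monom k * p - smult t p = pderiv T - [:a, 0, 1:] * T"
  proof -
    have t: "fact k * fact (n - k) * coeff p (n - k) / fact n = fact k * t"
      using coeff_p[of "n - k"] by (simp add: t_def)
    have "exp_monom k * p - smult t p = smult (1 / fact k) (monom 1 k * p) - smult t p"
      by (simp add: exp_monom_def smult_monom flip: mult_smult_left)
    then have "coeff (redA a (exp_monom k * p - smult t p)) 0 = 0"
      "coeff (redB a (exp_monom k * p - smult t p)) 0 = 0"
      using redA0.wave_moments[OF ode deg lead k] redB0.wave_moments[OF ode deg lead k]
      unfolding t by simp_all
    with reduction[of "exp_monom k * p - smult t p" a] that show ?thesis
      by auto
  qed
  define Q where "Q = reflect_arg T"
  define X where "X = reflect_arg (exp_monom k) * P"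
  have "X - smult t P = - (pderiv Q + H * Q)"
    using reflect_arg_exact[of T a, folded T]
    unfolding X_def P_def Q_def H_def reflect_arg_simps .
  then have X: "X = smult t P - (pderiv Q + H * Q)"
    by (simp add: algebra_simps)
  define r where "r = smult t r0 - Q * p"
  have "pderiv r * p - r * pderiv p + H * r * p =
      smult t (pderiv r0 * p - r0 * pderiv p + H * r0 * p) - p ^ 2 * (pderiv Q + H * Q)"
    by (simp add: r_def pderiv_diff pderiv_mult pderiv_smult algebra_simps smult_add_right
        smult_diff_right power2_eq_square)
  also have "\<dots> = p ^ 2 * X - [:t * \<kappa>:]"
    unfolding r0 X by (simp add: algebra_simps smult_diff_right)
  finally have r: "pderiv r * p - r * pderiv p + pderiv h * r * p = p ^ 2 * X - [:t * \<kappa>:]"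
    unfolding h H_def .
  have "t * \<kappa> = (-1) ^ n * c (n - k)"
    by (simp add: t_def \<kappa>_def)
  with r have "D_map h (Fract r p) = Fract (p ^ 2 * X - [:(-1) ^ n * c (n - k):]) (p ^ 2)"
    by (simp only: D_map_Fract[OF p0])
  also have "\<dots> = to_fract X - to_fract [:(-1) ^ n * c (n - k):] / (to_fract p) ^ 2"
    using p0 by (simp add: to_fract_def power2_eq_square eq_fract algebra_simps)
  finally show "D_equiv h (to_fract (reflect_arg (exp_monom k) * reflect_arg p))
      (to_fract [:(-1)^n * c (n - k):] / (to_fract p)^2)"
    unfolding D_equiv_def X_def P_def by (metis rangeI)
qed

end
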